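(* There is an absolute constant $c>0$ such that the following holds. Let $n \geq 1$, $G := \mathbb{F}_2^n$, and let $A \subset G$ have density $\alpha := |A|/|G| > 0$. Then $A+A$ contains a (linear) subspace of $G$ of dimension at least $c\,\alpha n$.
   Context: $A+A := \{a+a' : a,a' \in A\}$.
   Formalization: If A is a singleton, then A+A = {0} and the bound cαn > 0 fails, so the bound "dimension at least cαn" is proved for every A with more than one element; for singletons only the bound with the integer part of cαn is claimed. *)

theory Defs
  imports Complex_Main "HOL-Library.Z2" "HOL-Library.Function_Algebras" "HOL-Library.Set_Algebras"
begin

text \<open>
  Since \<open>n\<close> is quantified after the absolute constant, \<open>F\<^sub>2\<^sup>n\<close> cannot be rendered with a type-indexed
  dimension. It is the subspace of the pointwise \<open>F\<^sub>2\<close>-vector space of all sequences that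
  consists of those vanishing from index \<open>n\<close> on. Subspaces and dimension are the notions of
  the locale \<open>vector_space\<close>, and \<open>A + A\<close> is the sumset of \<open>Set_Algebras\<close>.
\<close>

definition f2_scale :: "bit \<Rightarrow> (nat \<Rightarrow> bit) \<Rightarrow> nat \<Rightarrow> bit"
  where "f2_scale c x = (\<lambda>i. c * x i)"

global_interpretation f2: vector_space f2_scale
proof
  fix a b :: bit and x y :: "nat \<Rightarrow> bit"
  show "f2_scale a (x + y) = f2_scale a x + f2_scale a y"
    unfolding f2_scale_def plus_fun_def by (simp only: distrib_left)
  show "f2_scale (a + b) x = f2_scale a x + f2_scale b x"
    unfolding f2_scale_def plus_fun_def by (simp only: distrib_right)
  show "f2_scale a (f2_scale b x) = f2_scale (a * b) x"
    unfolding f2_scale_def by (simp only: mult.assoc)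
  show "f2_scale 1 x = x"
    unfolding f2_scale_def by (simp only: mult_1_left)
qed

definition F2n :: "nat \<Rightarrow> (nat \<Rightarrow> bit) set"
  where "F2n n = {x. \<forall>i\<ge>n. x i = 0}"

lemma subspace_F2n: "f2.subspace (F2n n)"
  by (simp add: f2.subspace_def F2n_def f2_scale_def)

lemma card_F2n: "card (F2n n) = 2 ^ n"
proof -
  have "card (F2n n) = card (Pow {..<n})"
  proof (rule bij_betw_same_card)
    show "bij_betw (\<lambda>x. {i. x i = 1}) (F2n n) (Pow {..<n})"
    proof (rule bij_betw_byWitness[where f' = "\<lambda>S i. if i \<in> S then 1 else 0"])
      show "(\<lambda>x. {i. x i = 1}) ` F2n n \<subseteq> Pow {..<n}"
        by (force simp: F2n_def not_less[symmetric])
      show "(\<lambda>S i. if i \<in> S then 1 else 0) ` Pow {..<n} \<subseteq> F2n n"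
        by (force simp: F2n_def)
      show "\<forall>x\<in>F2n n. (\<lambda>i. if i \<in> {i. x i = 1} then 1 else 0) = x"
        by (auto simp: fun_eq_iff)
      show "\<forall>S\<in>Pow {..<n}. {i. (if i \<in> S then 1 else (0::bit)) = 1} = S"
        by auto
    qed
  qed
  then show ?thesis
    by (simp add: card_Pow)
qed

definition rel_density :: "nat \<Rightarrow> (nat \<Rightarrow> bit) set \<Rightarrow> real"
  where "rel_density n A = real (card A) / real (card (F2n n))"

text \<open>
  A lower bound \<open>dim V \<ge> c \<alpha> n\<close> fails for every \<open>c > 0\<close> when \<open>A\<close> is a singleton: then
  \<open>A + A = {0}\<close> only contains the subspace of dimension 0, while \<open>c \<alpha> n > 0\<close>. The theorem
  therefore states \<open>dim V \<ge> \<lfloor>c \<alpha> n\<rfloor>\<close> for all nonempty \<open>A\<close>, and the bound without the integer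
  part whenever \<open>A\<close> is not a singleton.
\<close>

end

theory Submission imports Defs begin

text \<open>
  Let \<open>A\<close> have density \<open>\<alpha>\<close> in a subspace \<open>V\<close> and put \<open>S = V - (A + A)\<close>. The numbers
  \<open>\<bar>A^(\<gamma>)\<bar>\<^sup>2\<close> are nonnegative weights on the characters, and \<open>\<Sum> \<bar>A^(\<gamma>)\<bar>\<^sup>2 \<gamma>(x)\<close>
  counts the representations \<open>x = a + a'\<close>, so it vanishes on \<open>S\<close>: on average \<open>\<gamma>\<close> is biased
  towards \<open>-1\<close> on \<open>S\<close>, with a gain of a factor \<open>1 + \<alpha>/2\<close> because the trivial character
  carries a proportion \<open>\<alpha>\<close> of the weight without contributing any bias.
  Restricting to \<open>{\<gamma> = -1}\<close> again and again, the density of \<open>S\<close> grows by \<open>1 + \<alpha>/2\<close> for each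
  codimension, provided that \<open>\<gamma>\<close> can always be chosen outside the span of its predecessors.
  If \<open>S\<close> has density more than \<open>2\<^sup>-\<^sup>d\<close>, this must fail within \<open>O(d/\<alpha>)\<close> steps; then
  much of the weight lies on a span of few characters, which means that \<open>A\<close> has density at least
  \<open>5\<alpha>/4\<close> on a coset of a subspace of codimension \<open>O(d/\<alpha>)\<close>. As translating \<open>A\<close> does not
  change \<open>A + A\<close>, this can be iterated, and the codimensions form a geometric series. So \<open>A + A\<close>
  contains all but a proportion \<open>2\<^sup>-\<^sup>d\<close> of a subspace of codimension \<open>O(d/\<alpha>)\<close>, and a greedy
  choice of basis vectors gives a subspace of dimension \<open>d\<close> inside \<open>A + A\<close>.
\<close>

section \<open>Characters of \<open>F2n n\<close>, orthogonality and annihilators\<close>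

text \<open>This is \<open>(-1)\<close> to the inner product of \<open>g\<close> and
  \<open>x\<close>, so \<open>F2n n\<close> indexes its own characters and all of them are real. The
  formula is symmetric, which lets one orthogonality argument serve for sums over \<open>x\<close>
  and for sums over \<open>g\<close>.\<close>

definition f2_char :: "nat \<Rightarrow> (nat \<Rightarrow> bit) \<Rightarrow> (nat \<Rightarrow> bit) \<Rightarrow> real"
  where "f2_char n g x = (\<Prod>i<n. if g i = 1 \<and> x i = 1 then -1 else 1)"

definition annihilator :: "nat \<Rightarrow> (nat \<Rightarrow> bit) set \<Rightarrow> (nat \<Rightarrow> bit) set"
  where "annihilator n V = {g \<in> F2n n. \<forall>v\<in>V. f2_char n g v = 1}"

lemma bit_fun_add_self [simp]: "x + x = (0 :: nat \<Rightarrow> bit)"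
  by (simp add: fun_eq_iff)

lemma bit_fun_add_left_cancel [simp]: "x + (x + y) = (y :: nat \<Rightarrow> bit)"
  by (simp add: add.assoc[symmetric])

lemma bit_fun_add_eq_iff: "x + y = z \<longleftrightarrow> y = x + (z :: nat \<Rightarrow> bit)"
  by (metis bit_fun_add_left_cancel)

lemma bit_fun_add_eq_0_iff: "x + y = 0 \<longleftrightarrow> x = (y :: nat \<Rightarrow> bit)"
  by (metis bit_fun_add_left_cancel bit_fun_add_self)

lemma f2_subspaceI:
  assumes "0 \<in> V" "\<And>x y. x \<in> V \<Longrightarrow> y \<in> V \<Longrightarrow> x + y \<in> V"
  shows "f2.subspace V"
proof -
  have "f2_scale c x = (if c = 0 then 0 else x)" for c x
    by (cases c) (auto simp: f2_scale_def fun_eq_iff)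
  then show ?thesis
    using assms by (auto simp: f2.subspace_def)
qed

lemma finite_F2n: "finite (F2n n)"
  using card_F2n[of n] by (intro card_ge_0_finite) simp

lemma f2_char_add: "f2_char n g (x + y) = f2_char n g x * f2_char n g y"
proof -
  have "(if g i = 1 \<and> (x + y) i = 1 then -1 else 1) =
    (if g i = 1 \<and> x i = 1 then -1 else 1) * (if g i = 1 \<and> y i = 1 then -1 else (1::real))" for i
    by (cases "x i"; cases "y i") auto
  then show ?thesis
    by (simp add: f2_char_def prod.distrib)
qed

lemma f2_char_commute: "f2_char n g x = f2_char n x g"
  by (simp add: f2_char_def conj_commute)

lemma f2_char_cases: "f2_char n g x = 1 \<or> f2_char n g x = -1"
  unfolding f2_char_def by (induction n) auto

lemma f2_char_0 [simp]: "f2_char n g 0 = 1"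
  by (simp add: f2_char_def)

text \<open>Translation by \<open>v\<close> permutes \<open>V\<close> and multiplies the sum by
  \<open>f v\<close>, which differs from 1.\<close>

lemma sum_character_eq_0:
  fixes f :: "(nat \<Rightarrow> bit) \<Rightarrow> real"
  assumes V: "f2.subspace V" and f: "\<And>x y. f (x + y) = f x * f y"
    and v: "v \<in> V" "f v \<noteq> 1"
  shows "sum f V = 0"
proof -
  have "bij_betw ((+) v) V V"
    by (rule bij_betw_byWitness[where f' = "(+) v"]) (use V v f2.subspace_add in auto)
  then have "sum f V = (\<Sum>x\<in>V. f (v + x))"
    by (rule sum.reindex_bij_betw[symmetric])
  also have "\<dots> = f v * sum f V"
    by (simp add: f sum_distrib_left)
  finally show ?thesis
    using v by auto
qed

lemma sum_f2_char_subspace: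
  assumes V: "f2.subspace V" and g: "g \<in> F2n n"
  shows "(\<Sum>v\<in>V. f2_char n g v) = (if g \<in> annihilator n V then real (card V) else 0)"
proof (cases "g \<in> annihilator n V")
  case True
  then show ?thesis by (simp add: annihilator_def)
next
  case False
  then obtain v where "v \<in> V" "f2_char n g v \<noteq> 1"
    using g by (auto simp: annihilator_def)
  with False show ?thesis
    using sum_character_eq_0[OF V, of "f2_char n g" v] by (simp add: f2_char_add)
qed

lemma sum_f2_char_F2n:
  assumes x: "x \<in> F2n n"
  shows "(\<Sum>g\<in>F2n n. f2_char n g x) = (if x = 0 then 2 ^ n else 0)"
proof (cases "x = 0")
  case False
  then obtain i where i: "x i = 1"
    by (auto simp: fun_eq_iff)
  with x have "i < n"
    by (force simp: F2n_def not_less[symmetric])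
  \<comment> \<open>The unit vector at a coordinate where \<open>x\<close> is 1 witnesses that
    \<open>f2_char n x\<close> is not trivial.\<close>
  define e :: "nat \<Rightarrow> bit" where "e = (\<lambda>j. if j = i then 1 else 0)"
  have e: "e \<in> F2n n"
    using \<open>i < n\<close> by (auto simp: e_def F2n_def)
  have "f2_char n x e = (\<Prod>j<n. if j = i then -1 else 1)"
    unfolding f2_char_def by (rule prod.cong) (auto simp: e_def i)
  then have "f2_char n x e = -1"
    using \<open>i < n\<close> by (simp add: prod.delta)
  with sum_character_eq_0[OF subspace_F2n[of n], of "f2_char n x" e] e
  have "(\<Sum>g\<in>F2n n. f2_char n x g) = 0"
    by (simp add: f2_char_add)
  with False show ?thesis
    by (simp add: f2_char_commute)
qed (simp add: card_F2n)

text \<open>Both sides evaluate the sum of \<open>f2_char n g v\<close> over all \<open>g\<close> in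
  \<open>F2n n\<close> and \<open>v\<close> in \<open>V\<close>: summing over \<open>v\<close> first
  leaves the annihilator, summing over \<open>g\<close> first leaves only
  \<open>v = 0\<close>.\<close>

lemma card_annihilator:
  assumes V: "f2.subspace V" "V \<subseteq> F2n n"
  shows "real (card (annihilator n V)) * real (card V) = 2 ^ n"
proof -
  have fin: "finite V"
    using V finite_F2n finite_subset by blast
  have sub: "annihilator n V \<subseteq> F2n n"
    by (auto simp: annihilator_def)
  have "real (card (annihilator n V)) * real (card V) =
      (\<Sum>g\<in>F2n n. if g \<in> annihilator n V then real (card V) else 0)"
    using sub finite_F2n[of n] by (simp add: sum.If_cases Int_absorb1)
  also have "\<dots> = (\<Sum>g\<in>F2n n. \<Sum>v\<in>V. f2_char n g v)"
    using V by (intro sum.cong) (auto simp: sum_f2_char_subspace)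
  also have "\<dots> = (\<Sum>v\<in>V. \<Sum>g\<in>F2n n. f2_char n g v)"
    by (rule sum.swap)
  also have "\<dots> = (\<Sum>v\<in>V. if v = 0 then 2 ^ n else 0)"
    using V by (intro sum.cong) (auto simp: sum_f2_char_F2n subset_iff)
  also have "\<dots> = 2 ^ n"
    using V fin f2.subspace_0 by (simp add: sum.delta')
  finally show ?thesis .
qed

section \<open>Fourier energy of a set\<close>

text \<open>The squared Fourier coefficient of the indicator function of \<open>A\<close>, without
  normalisation; characters are real, so no absolute value is taken.\<close>

definition energy :: "nat \<Rightarrow> (nat \<Rightarrow> bit) set \<Rightarrow> (nat \<Rightarrow> bit) \<Rightarrow> real"
  where "energy n A g = (\<Sum>a\<in>A. f2_char n g a) ^ 2"

lemma energy_nonneg [simp]: "energy n A g \<ge> 0"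
  by (simp add: energy_def)

text \<open>Expanding the square gives characters at \<open>a + b + x\<close>, and orthogonality
  keeps only the pairs with \<open>b = x + a\<close>. For \<open>x\<close> outside
  \<open>A + A\<close> the sum therefore vanishes.\<close>

lemma sum_energy_f2_char:
  assumes A: "A \<subseteq> F2n n" and x: "x \<in> F2n n"
  shows "(\<Sum>g\<in>F2n n. energy n A g * f2_char n g x) = 2 ^ n * real (card {a \<in> A. x + a \<in> A})"
proof -
  have fin: "finite A"
    using A finite_F2n finite_subset by blast
  have *: "a + b + x = 0 \<longleftrightarrow> b = x + a" for a b
    by (metis add.commute bit_fun_add_eq_0_iff bit_fun_add_eq_iff)
  have mem: "a + b + x \<in> F2n n" if "a \<in> A" "b \<in> A" for a b
    using that A x f2.subspace_add[OF subspace_F2n] by blast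
  have "(\<Sum>g\<in>F2n n. energy n A g * f2_char n g x) =
      (\<Sum>g\<in>F2n n. \<Sum>a\<in>A. \<Sum>b\<in>A. f2_char n g (a + b + x))"
    by (simp add: energy_def power2_eq_square sum_product[symmetric] f2_char_add
      sum_distrib_right[symmetric])
  also have "\<dots> = (\<Sum>a\<in>A. \<Sum>g\<in>F2n n. \<Sum>b\<in>A. f2_char n g (a + b + x))"
    by (rule sum.swap)
  also have "\<dots> = (\<Sum>a\<in>A. \<Sum>b\<in>A. \<Sum>g\<in>F2n n. f2_char n g (a + b + x))"
    by (intro sum.cong refl sum.swap)
  also have "\<dots> = (\<Sum>a\<in>A. \<Sum>b\<in>A. if b = x + a then 2 ^ n else 0)"
    by (intro sum.cong refl) (simp add: sum_f2_char_F2n[OF mem] *)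
  also have "\<dots> = (\<Sum>a\<in>A. if x + a \<in> A then 2 ^ n else 0)"
    using fin by (simp add: sum.delta')
  also have "\<dots> = 2 ^ n * real (card {a \<in> A. x + a \<in> A})"
    using fin by (simp add: sum.If_cases Int_def)
  finally show ?thesis .
qed

lemma sum_energy:
  assumes "A \<subseteq> F2n n"
  shows "(\<Sum>g\<in>F2n n. energy n A g) = 2 ^ n * real (card A)"
  using sum_energy_f2_char[OF assms, of 0] f2.subspace_0[OF subspace_F2n] by simp

text \<open>Summing a character over \<open>W\<close> detects membership in the annihilator, so this
  is the previous count summed over \<open>x\<close> in \<open>W\<close>. It turns a bound for
  \<open>A\<close> on cosets of \<open>W\<close> into a bound for the energy on
  \<open>annihilator n W\<close>.\<close>

lemma sum_energy_annihilator:
  assumes A: "A \<subseteq> F2n n" and W: "f2.subspace W" "W \<subseteq> F2n n"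
  shows "real (card W) * (\<Sum>g\<in>annihilator n W. energy n A g) =
    2 ^ n * (\<Sum>a\<in>A. real (card (A \<inter> (+) a ` W)))"
proof -
  have finA: "finite A" and finW: "finite W"
    using A W finite_F2n finite_subset by blast+
  have sub: "annihilator n W \<subseteq> F2n n"
    by (auto simp: annihilator_def)
  have "real (card W) * (\<Sum>g\<in>annihilator n W. energy n A g) =
      (\<Sum>g\<in>F2n n. if g \<in> annihilator n W then energy n A g * real (card W) else 0)"
    using sub finite_F2n[of n]
    by (simp add: sum.If_cases Int_absorb1 sum_distrib_left mult.commute)
  also have "\<dots> = (\<Sum>g\<in>F2n n. \<Sum>w\<in>W. energy n A g * f2_char n g w)"
    using W by (intro sum.cong) (auto simp: sum_distrib_left[symmetric] sum_f2_char_subspace)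
  also have "\<dots> = (\<Sum>w\<in>W. \<Sum>g\<in>F2n n. energy n A g * f2_char n g w)"
    by (rule sum.swap)
  also have "\<dots> = (\<Sum>w\<in>W. 2 ^ n * (\<Sum>a\<in>A. if w + a \<in> A then 1 else 0))"
    using W finA by (intro sum.cong refl)
      (auto simp: sum_energy_f2_char[OF A] subset_iff sum.If_cases Int_def)
  also have "\<dots> = 2 ^ n * (\<Sum>a\<in>A. \<Sum>w\<in>W. if w + a \<in> A then 1 else 0)"
    by (subst sum.swap) (simp add: sum_distrib_left)
  also have "(\<Sum>a\<in>A. \<Sum>w\<in>W. if w + a \<in> A then 1 else 0) =
      (\<Sum>a\<in>A. real (card (A \<inter> (+) a ` W)))"
  proof (rule sum.cong[OF refl])
    fix a
    have "A \<inter> (+) a ` W = (+) a ` {w \<in> W. w + a \<in> A}"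
      by (auto simp: add.commute)
    moreover have "inj_on ((+) a) X" for X
      by (auto simp: inj_on_def)
    ultimately show "(\<Sum>w\<in>W. if w + a \<in> A then 1 else 0) = real (card (A \<inter> (+) a ` W))"
      using finW by (simp add: sum.If_cases Int_def card_image)
  qed
  finally show ?thesis .
qed

section \<open>Biased characters and the density increment\<close>

text \<open>An averaging argument with the energies as weights. Excluding
  \<open>annihilator n W\<close> guarantees that \<open>g\<close> cuts \<open>W\<close> into two
  halves; \<open>no_inc\<close> makes this exclusion cheap.\<close>

lemma ex_biased_character:
  assumes V: "f2.subspace V" "V \<subseteq> F2n n" and A: "A \<subseteq> V" "A \<noteq> {}"
    and W: "f2.subspace W" "W \<subseteq> V"
    and dens: "real (card A) = \<alpha> * real (card V)"
    and no_inc: "\<And>x. real (card (A \<inter> (+) x ` W)) \<le> 5/4 * \<alpha> * real (card W)"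
    and X: "X \<subseteq> V" "X \<noteq> {}" "X \<inter> (A + A) = {}"
  obtains g where "g \<in> F2n n - annihilator n W"
    "(\<Sum>x\<in>X. 1 - f2_char n g x) > (1 + \<alpha>/2) * real (card X)"
proof -
  let ?E = "energy n A"
  define G0 G1 where "G0 = annihilator n V" and "G1 = annihilator n W"
  have fin: "finite A" "finite V" "finite W" "finite X"
    using A V W X finite_F2n by (meson finite_subset)+
  have cA: "real (card A) > 0" and cV: "real (card V) > 0" and cX: "real (card X) > 0"
    and cW: "real (card W) > 0"
    using fin A X f2.subspace_0[OF V(1)] f2.subspace_0[OF W(1)] by (auto simp: card_gt_0_iff)
  have \<alpha>: "\<alpha> > 0"
    using dens cA cV by (smt (verit) mult_nonpos_nonneg)
  have An: "A \<subseteq> F2n n" and Wn: "W \<subseteq> F2n n"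
    using A V W by auto
  have sub: "G0 \<subseteq> G1" "G1 \<subseteq> F2n n"
    using W by (auto simp: G0_def G1_def annihilator_def)
  have finG: "finite (F2n n)" "finite G1" "finite G0"
    using sub finite_F2n finite_subset by metis+
  define N where "N = (2::real) ^ n * real (card A)"
  have N: "N > 0"
    using cA by (simp add: N_def)
  have total: "(\<Sum>g\<in>F2n n. ?E g) = N"
    using sum_energy[OF An] by (simp add: N_def)
  have low: "(\<Sum>g\<in>G0. ?E g) = \<alpha> * N"
  proof -
    have "?E g = real (card A) ^ 2" if "g \<in> G0" for g
    proof -
      have "(\<Sum>a\<in>A. f2_char n g a) = (\<Sum>a\<in>A. 1)"
        using that A by (intro sum.cong) (auto simp: G0_def annihilator_def)
      then show ?thesis by (simp add: energy_def)
    qed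
    then have "(\<Sum>g\<in>G0. ?E g) = real (card G0) * real (card A) ^ 2"
      by simp
    also have "\<dots> = \<alpha> * real (card A) * (real (card G0) * real (card V))"
      by (simp add: dens power2_eq_square)
    also have "\<dots> = \<alpha> * N"
      using card_annihilator[OF V] by (simp add: N_def G0_def)
    finally show ?thesis .
  qed
  have high: "(\<Sum>g\<in>G1. ?E g) \<le> 5/4 * \<alpha> * N"
  proof -
    have "real (card W) * (\<Sum>g\<in>G1. ?E g) = 2 ^ n * (\<Sum>a\<in>A. real (card (A \<inter> (+) a ` W)))"
      unfolding G1_def by (rule sum_energy_annihilator[OF An W(1) Wn])
    also have "\<dots> \<le> 2 ^ n * (\<Sum>a\<in>A. 5/4 * \<alpha> * real (card W))"
      by (intro mult_left_mono sum_mono no_inc) auto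
    also have "\<dots> = real (card W) * (5/4 * \<alpha> * N)"
      by (simp add: N_def)
    finally show ?thesis
      using cW by (simp del: of_nat_0_less_iff)
  qed
  have split: "(\<Sum>g\<in>F2n n - G1. f g) = (\<Sum>g\<in>F2n n. f g) - (\<Sum>g\<in>G1. f g)"
    "(\<Sum>g\<in>G1 - G0. f g) = (\<Sum>g\<in>G1. f g) - (\<Sum>g\<in>G0. f g)" for f :: "_ \<Rightarrow> real"
    using sub finG by (simp_all add: sum_diff)
  \<comment> \<open>The weights times \<open>1 - f2_char n g x\<close> add up to \<open>N\<close>
    over all of \<open>F2n n\<close>. Characters in \<open>G0\<close> contribute 0, and
    \<open>G1 - G0\<close> has weight at most \<open>(5/4 - 1) * \<alpha> * N\<close>, each unit of
    which contributes at most 2.\<close>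
  have pt: "(\<Sum>g\<in>F2n n - G1. ?E g * (1 - f2_char n g x)) \<ge> N - \<alpha>/2 * N" if x: "x \<in> X" for x
  proof -
    have xV: "x \<in> V" "x \<in> F2n n"
      using x X V by auto
    have "x + a \<notin> A" if "a \<in> A" for a
    proof
      assume "x + a \<in> A"
      then have "x + a + a \<in> A + A"
        using that by (rule set_plus_intro)
      with x X show False
        by (auto simp: add.assoc)
    qed
    then have "{a \<in> A. x + a \<in> A} = {}"
      by auto
    then have "(\<Sum>g\<in>F2n n. ?E g * f2_char n g x) = 0"
      using sum_energy_f2_char[OF An xV(2)]
      by (simp only: card.empty of_nat_0 mult_zero_right)
    then have "(\<Sum>g\<in>F2n n. ?E g * (1 - f2_char n g x)) = N"
      by (simp add: right_diff_distrib sum_subtractf total)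
    moreover have "(\<Sum>g\<in>G0. ?E g * (1 - f2_char n g x)) = 0"
      using xV by (intro sum.neutral) (auto simp: G0_def annihilator_def)
    moreover have "(\<Sum>g\<in>G1 - G0. ?E g * (1 - f2_char n g x)) \<le> (\<Sum>g\<in>G1 - G0. ?E g * 2)"
      using f2_char_cases[of n _ x] by (intro sum_mono mult_left_mono) (smt (verit), simp)
    moreover have "(\<Sum>g\<in>G1 - G0. ?E g * 2) = 2 * ((\<Sum>g\<in>G1. ?E g) - (\<Sum>g\<in>G0. ?E g))"
      unfolding sum_distrib_right[symmetric] split by simp
    then have "(\<Sum>g\<in>G1 - G0. ?E g * 2) \<le> \<alpha>/2 * N"
      using low high by (simp add: algebra_simps)
    ultimately show ?thesis
      by (simp add: split)
  qed
  \<comment> \<open>The excess of \<open>g\<close> over the required bias; a positive weighted sum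
    of excesses yields the character.\<close>
  define D where "D g = (\<Sum>x\<in>X. 1 - f2_char n g x) - (1 + \<alpha>/2) * real (card X)" for g
  have "(\<Sum>g\<in>G1. ?E g) \<ge> (\<Sum>g\<in>G0. ?E g)"
    using sub finG by (intro sum_mono2) auto
  then have "(\<Sum>g\<in>F2n n - G1. ?E g) \<le> N - \<alpha> * N"
    using low total by (simp add: split)
  then have rest: "(1 + \<alpha>/2) * real (card X) * (\<Sum>g\<in>F2n n - G1. ?E g)
      \<le> (1 + \<alpha>/2) * real (card X) * (N - \<alpha> * N)"
    using \<alpha> by (intro mult_left_mono) auto
  have "real (card X) * (N - \<alpha>/2 * N) = (\<Sum>x\<in>X. N - \<alpha>/2 * N)"
    by simp
  also have "\<dots> \<le> (\<Sum>x\<in>X. \<Sum>g\<in>F2n n - G1. ?E g * (1 - f2_char n g x))"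
    by (intro sum_mono pt)
  finally have "real (card X) * (N - \<alpha>/2 * N) - (1 + \<alpha>/2) * real (card X) * (N - \<alpha> * N)
      \<le> (\<Sum>x\<in>X. \<Sum>g\<in>F2n n - G1. ?E g * (1 - f2_char n g x))
        - (1 + \<alpha>/2) * real (card X) * (\<Sum>g\<in>F2n n - G1. ?E g)"
    using rest by (rule diff_mono)
  also have "\<dots> = (\<Sum>g\<in>F2n n - G1. ?E g * D g)"
    unfolding D_def right_diff_distrib sum_subtractf
    by (subst sum.swap) (simp add: sum_distrib_left mult_ac right_diff_distrib sum_subtractf)
  finally have "real (card X) * (N - \<alpha>/2 * N) - (1 + \<alpha>/2) * real (card X) * (N - \<alpha> * N)
      \<le> (\<Sum>g\<in>F2n n - G1. ?E g * D g)" .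
  \<comment> \<open>The surplus comes from \<open>(1 - \<alpha>/2) - (1 + \<alpha>/2) * (1 -
    \<alpha>) = \<alpha>\<^sup>2 / 2\<close>.\<close>
  moreover have "real (card X) * (N - \<alpha>/2 * N) - (1 + \<alpha>/2) * real (card X) * (N - \<alpha> * N)
      = real (card X) * N * (\<alpha>\<^sup>2 / 2)"
    by (simp add: field_simps power2_eq_square)
  moreover have "real (card X) * N * (\<alpha>\<^sup>2 / 2) > 0"
    using cX N \<alpha> by simp
  ultimately have "(\<Sum>g\<in>F2n n - G1. ?E g * D g) > 0"
    by linarith
  then obtain g where "g \<in> F2n n - G1" "?E g * D g > 0"
    by (metis (no_types, lifting) not_less sum_nonpos)
  then have "D g > 0"
    using energy_nonneg[of n A g] by (auto simp: zero_less_mult_iff)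
  with \<open>g \<in> F2n n - G1\<close> show thesis
    by (intro that) (auto simp: G1_def D_def)
qed

text \<open>Translation by \<open>w\<close> interchanges the parts of \<open>W\<close> on which the
  character is 1 and -1.\<close>

lemma card_hyperplane:
  assumes W: "f2.subspace W" "finite W" and w: "w \<in> W" "f2_char n g w \<noteq> 1"
  shows "card W = 2 * card {v \<in> W. f2_char n g v = 1}"
proof -
  let ?U = "{v \<in> W. f2_char n g v = 1}"
  have gw: "f2_char n g w = -1"
    using w f2_char_cases by blast
  have W_eq: "W = ?U \<union> (+) w ` ?U"
  proof
    show "W \<subseteq> ?U \<union> (+) w ` ?U"
    proof
      fix v assume v: "v \<in> W"
      show "v \<in> ?U \<union> (+) w ` ?U"
      proof (cases "f2_char n g v = 1")
        case False
        then have "w + v \<in> ?U"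
          using v w gw W f2.subspace_add f2_char_cases[of n g v] by (auto simp: f2_char_add)
        moreover have "v = w + (w + v)"
          by simp
        ultimately show ?thesis
          by blast
      qed (use v in auto)
    qed
    show "?U \<union> (+) w ` ?U \<subseteq> W"
      using w W f2.subspace_add by auto
  qed
  have "?U \<inter> (+) w ` ?U = {}"
    by (auto simp: f2_char_add gw)
  then have "card (?U \<union> (+) w ` ?U) = card ?U + card ((+) w ` ?U)"
    using W by (intro card_Un_disjoint) auto
  also have "card ((+) w ` ?U) = card ?U"
    by (intro card_image) (auto simp: inj_on_def)
  finally have "card (?U \<union> (+) w ` ?U) = 2 * card ?U"
    by linarith
  with W_eq show ?thesis
    by metis
qed

text \<open>Without an increment, a biased character is available at each of \<open>m * d\<close>
  successive halvings, and the density of the complement of \<open>A + A\<close> would be pushed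
  above 1.\<close>

lemma density_increment:
  assumes V: "f2.subspace V" "V \<subseteq> F2n n" and A: "A \<subseteq> V" "A \<noteq> {}"
    and dens: "real (card A) = \<alpha> * real (card V)"
    and miss: "2 ^ d * real (card (V - (A + A))) > real (card V)"
    and m: "2 / \<alpha> \<le> real m"
  shows "\<exists>W x. f2.subspace W \<and> W \<subseteq> V \<and> card V \<le> 2 ^ (m * d) * card W \<and>
    real (card (A \<inter> (+) x ` W)) > 5/4 * \<alpha> * real (card W)"
proof (rule ccontr)
  assume contra: "\<not> ?thesis"
  have no_inc: "real (card (A \<inter> (+) x ` W)) \<le> 5/4 * \<alpha> * real (card W)"
    if "f2.subspace W" "W \<subseteq> V" "card V \<le> 2 ^ (m * d) * card W" for W x
    using that contra by (meson not_le)
  have fin: "finite V" "finite A"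
    using A V finite_F2n by (meson finite_subset)+
  have "real (card A) > 0"
    using fin A by (auto simp: card_gt_0_iff)
  then have \<alpha>: "\<alpha> > 0"
    using dens by (smt (verit) mult_nonpos_nonneg of_nat_0_le_iff)
  define S where "S = V - (A + A)"
  \<comment> \<open>Invariant: on a coset of a subspace of codimension \<open>j\<close>, the density
    of \<open>S\<close> exceeds \<open>(1 + \<alpha>/2) ^ j / 2 ^ d\<close>.\<close>
  have "\<exists>W h. f2.subspace W \<and> W \<subseteq> V \<and> h \<in> V \<and> card V = 2 ^ j * card W \<and>
      2 ^ d * real (card (S \<inter> (+) h ` W)) > (1 + \<alpha>/2) ^ j * real (card W)" if "j \<le> m * d" for j
    using that
  proof (induction j)
    case 0
    have "(+) 0 ` V = V"
      by (auto simp: image_def)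
    then have "S \<inter> (+) 0 ` V = S"
      by (simp only: Int_absorb2 S_def Diff_subset)
    then show ?case
      using V(1) f2.subspace_0[OF V(1)] miss
      by (intro exI[of _ V] exI[of _ 0] conjI) (simp_all only: S_def, simp_all)
  next
    case (Suc j)
    then obtain W h where W: "f2.subspace W" "W \<subseteq> V" and h: "h \<in> V"
      and cW: "card V = 2 ^ j * card W"
      and S: "2 ^ d * real (card (S \<inter> (+) h ` W)) > (1 + \<alpha>/2) ^ j * real (card W)"
      by (metis Suc_leD)
    define X where "X = S \<inter> (+) h ` W"
    have finX: "finite X"
      using fin by (auto simp: X_def S_def)
    have finW: "finite W"
      using W fin finite_subset by blast
    have "(1 + \<alpha>/2) ^ j * real (card W) \<ge> 0"
      using \<alpha> by simp
    with S have "2 ^ d * real (card X) > 0"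
      unfolding X_def by (rule order.strict_trans1[rotated])
    then have "card X \<noteq> 0"
      by (intro notI) simp
    then have X: "X \<noteq> {}" "X \<subseteq> V" "X \<inter> (A + A) = {}"
      by (auto simp: X_def S_def)
    have "card V \<le> 2 ^ (m * d) * card W"
      unfolding cW using Suc.prems by (intro mult_right_mono power_increasing) auto
    note inc = no_inc[OF W this]
    obtain g where g: "g \<in> F2n n - annihilator n W"
      and gX: "(\<Sum>x\<in>X. 1 - f2_char n g x) > (1 + \<alpha>/2) * real (card X)"
      using ex_biased_character[OF V A W dens inc X(2,1,3)] by blast
    from g obtain w where w: "w \<in> W" "f2_char n g w \<noteq> 1"
      by (auto simp: annihilator_def)
    define W' where "W' = {v \<in> W. f2_char n g v = 1}"
    \<comment> \<open>\<open>X'\<close> keeps more than the proportion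
      \<open>(1 + \<alpha>/2) / 2\<close> of \<open>X\<close>, while \<open>W'\<close> is half of
      \<open>W\<close>, so the relative density gains the factor
      \<open>1 + \<alpha>/2\<close>.\<close>
    define X' where "X' = {x \<in> X. f2_char n g x = -1}"
    have W': "f2.subspace W'"
      using W f2.subspace_add f2.subspace_0 by (intro f2_subspaceI) (auto simp: W'_def f2_char_add)
    have "(\<Sum>x\<in>X. 1 - f2_char n g x) = (\<Sum>x\<in>X. if f2_char n g x = -1 then 2 else 0)"
      using f2_char_cases[of n g] by (intro sum.cong) force+
    also have "\<dots> = 2 * real (card X')"
      using finX by (simp add: sum.If_cases X'_def Int_def)
    finally have cX': "2 * real (card X') > (1 + \<alpha>/2) * real (card X)"
      using gX by simp
    moreover have "(1 + \<alpha>/2) * real (card X) \<ge> 0"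
      using \<alpha> by simp
    ultimately have "real (card X') > 0"
      by linarith
    then have "X' \<noteq> {}"
      by auto
    \<comment> \<open>Any point of \<open>X'\<close> can represent the new coset: two points of
      \<open>X'\<close> both have character value -1, so their sum has value 1 and lies in
      \<open>W'\<close>.\<close>
    then obtain h' where h': "h' \<in> X'"
      by blast
    have "X' \<subseteq> S \<inter> (+) h' ` W'"
    proof
      fix x assume x: "x \<in> X'"
      obtain u u' where u: "u \<in> W" "x = h + u" "u' \<in> W" "h' = h + u'"
        using x h' by (auto simp: X'_def X_def)
      have "h' + x = u' + u"
        unfolding u by (metis add.assoc add.commute bit_fun_add_left_cancel)
      then have "h' + x \<in> W"
        using u W f2.subspace_add by auto
      moreover have "f2_char n g (h' + x) = 1"
        using x h' by (auto simp: X'_def f2_char_add)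
      ultimately have "h' + x \<in> W'"
        by (simp add: W'_def)
      then have "h' + (h' + x) \<in> (+) h' ` W'"
        by blast
      then show "x \<in> S \<inter> (+) h' ` W'"
        using x by (simp add: X'_def X_def)
    qed
    moreover have "finite (S \<inter> (+) h' ` W')"
      using fin by (auto simp: S_def)
    ultimately have le: "real (card X') \<le> real (card (S \<inter> (+) h' ` W'))"
      by (simp add: card_mono)
    have half: "card W = 2 * card W'"
      unfolding W'_def by (rule card_hyperplane[OF W(1) finW w])
    have "(1 + \<alpha>/2) ^ Suc j * real (card W') * 2 = (1 + \<alpha>/2) * ((1 + \<alpha>/2) ^ j * real (card W))"
      by (simp add: half)
    also have "\<dots> < (1 + \<alpha>/2) * (2 ^ d * real (card X))"
      using S \<alpha> by (intro mult_strict_left_mono) (auto simp: X_def)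
    also have "\<dots> = 2 ^ d * ((1 + \<alpha>/2) * real (card X))"
      by simp
    also have "\<dots> < 2 ^ d * (2 * real (card X'))"
      using cX' by (intro mult_strict_left_mono) auto
    also have "\<dots> \<le> 2 ^ d * (2 * real (card (S \<inter> (+) h' ` W')))"
      using le by (intro mult_left_mono) auto
    finally have "2 ^ d * real (card (S \<inter> (+) h' ` W')) > (1 + \<alpha>/2) ^ Suc j * real (card W')"
      by simp
    moreover have "h' \<in> V"
      using h' by (auto simp: X'_def X_def S_def)
    moreover have "W' \<subseteq> V"
      using W by (auto simp: W'_def)
    moreover have "card V = 2 ^ Suc j * card W'"
      using cW half by simp
    ultimately show ?case
      using W' by blast
  qed
  from this[of "m * d"] obtain W h where W: "f2.subspace W" "W \<subseteq> V"
    and S: "2 ^ d * real (card (S \<inter> (+) h ` W)) > (1 + \<alpha>/2) ^ (m * d) * real (card W)"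
    by blast
  have "finite W"
    using W fin finite_subset by blast
  then have "card (S \<inter> (+) h ` W) \<le> card W"
    by (meson card_image_le card_mono finite_imageI inf_le2 order_trans)
  then have "2 ^ d * real (card (S \<inter> (+) h ` W)) \<le> 2 ^ d * real (card W)"
    by simp
  \<comment> \<open>By Bernoulli, \<open>m \<ge> 2 / \<alpha>\<close> steps double the density, so
    \<open>m * d\<close> steps make up for the initial \<open>2 ^ d\<close>.\<close>
  moreover have "(2::real) ^ d \<le> (1 + \<alpha>/2) ^ (m * d)"
  proof -
    have "2 \<le> 1 + real m * (\<alpha>/2)"
      using m \<alpha> by (simp add: field_simps)
    also have "\<dots> \<le> (1 + \<alpha>/2) ^ m"
      using \<alpha> by (intro Bernoulli_inequality) auto
    finally have "2 ^ d \<le> ((1 + \<alpha>/2) ^ m) ^ d"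
      by (intro power_mono) auto
    then show ?thesis
      by (simp add: power_mult)
  qed
  then have "2 ^ d * real (card W) \<le> (1 + \<alpha>/2) ^ (m * d) * real (card W)"
    by (intro mult_right_mono) auto
  ultimately show False
    using S by linarith
qed

section \<open>Iterating the increment\<close>

text \<open>Either \<open>V\<close> itself works, or the increment passes to a smaller subspace with
  density above \<open>5/4 * \<alpha>\<close>. One increment costs codimension at most
  \<open>3 * d / \<alpha>\<close>, and 15 is the constant with
  \<open>3 + 15 * 4/5 = 15\<close>.\<close>

lemma ex_subspace_almost_covered:
  assumes "f2.subspace V" "V \<subseteq> F2n n" "A \<subseteq> V" "A \<noteq> {}"
    and "\<alpha> > 0" and "real (card A) = \<alpha> * real (card V)"
  shows "\<exists>W. f2.subspace W \<and> W \<subseteq> V \<and> real (card V) \<le> 2 powr (15 * real d / \<alpha>) * real (card W) \<and>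
     2 ^ d * real (card (W - (A + A))) \<le> real (card W) \<and> 0 \<in> A + A"
  using assms
proof (induction "card V" arbitrary: V A \<alpha> rule: less_induct)
  case less
  note V = less.prems(1,2) and A = less.prems(3,4) and \<alpha> = less.prems(5) and dens = less.prems(6)
  have fin: "finite V" "finite A"
    using A V finite_F2n by (meson finite_subset)+
  have cV: "real (card V) > 0"
    using fin A by (auto simp: card_gt_0_iff)
  have "card A \<le> card V"
    using fin A by (intro card_mono)
  then have \<alpha>1: "\<alpha> \<le> 1"
    using dens cV by (smt (verit) mult_less_cancel_right1 of_nat_le_iff)
  obtain a where "a \<in> A"
    using A by blast
  then have zero: "0 \<in> A + A"
    using set_plus_intro[of a A a A] by simp
  show ?case
  proof (cases "2 ^ d * real (card (V - (A + A))) \<le> real (card V)")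
    case True
    moreover have "1 * real (card V) \<le> 2 powr (15 * real d / \<alpha>) * real (card V)"
      using \<alpha> by (intro mult_right_mono ge_one_powr_ge_zero) auto
    ultimately show ?thesis
      using V zero by (intro exI[of _ V]) auto
  next
    case False
    \<comment> \<open>Rounding up costs at most 1, which is at most \<open>1 / \<alpha>\<close>;
      hence the bound \<open>3 / \<alpha>\<close>.\<close>
    define m where "m = nat \<lceil>2 / \<alpha>\<rceil>"
    have m: "2 / \<alpha> \<le> real m" "real m \<le> 3 / \<alpha>"
    proof -
      show "2 / \<alpha> \<le> real m"
        unfolding m_def by linarith
      have "real m \<le> 2 / \<alpha> + 1"
        using \<alpha> unfolding m_def by (simp; linarith)
      also have "\<dots> \<le> 3 / \<alpha>"
        using \<alpha> \<alpha>1 by (simp add: field_simps)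
      finally show "real m \<le> 3 / \<alpha>" .
    qed
    obtain W x where W: "f2.subspace W" "W \<subseteq> V" and cVW: "card V \<le> 2 ^ (m * d) * card W"
      and inc: "real (card (A \<inter> (+) x ` W)) > 5/4 * \<alpha> * real (card W)"
      using density_increment[OF V A dens _ m(1), of d] False by auto
    have finW: "finite W"
      using W fin finite_subset by blast
    have cW: "real (card W) > 0"
      using finW f2.subspace_0[OF W(1)] by (auto simp: card_gt_0_iff)
    \<comment> \<open>The part of \<open>A\<close> in the coset is shifted into \<open>W\<close>. In
      \<open>B + B\<close> the two shifts by \<open>x\<close> cancel, so \<open>B + B\<close> stays
      inside \<open>A + A\<close>.\<close>
    define B where "B = (+) x ` (A \<inter> (+) x ` W)"
    define \<beta> where "\<beta> = real (card B) / real (card W)"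
    have "B \<subseteq> W"
      by (auto simp: B_def)
    have cB: "card B = card (A \<inter> (+) x ` W)"
      unfolding B_def by (intro card_image) (auto simp: inj_on_def)
    have \<beta>: "\<beta> > 5/4 * \<alpha>"
      using inc cW by (simp add: \<beta>_def cB field_simps)
    have "B \<noteq> {}"
      using \<beta> \<alpha> by (auto simp: \<beta>_def)
    have BA: "B + B \<subseteq> A + A"
    proof
      fix y assume "y \<in> B + B"
      then obtain a b where "a \<in> A" "b \<in> A" "y = (x + a) + (x + b)"
        by (auto simp: B_def elim!: set_plus_elim)
      moreover from this have "y = a + b"
        by (metis add.assoc add.commute bit_fun_add_left_cancel)
      ultimately show "y \<in> A + A"
        by auto
    qed
    \<comment> \<open>A proper subspace is needed for the induction on \<open>card V\<close>; the
      strict increment provides it.\<close>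
    have "W \<noteq> V"
    proof
      assume "W = V"
      then have "real (card (A \<inter> (+) x ` W)) \<le> \<alpha> * real (card W)"
        using fin by (simp add: dens[symmetric] card_mono)
      also have "\<dots> \<le> 5/4 * \<alpha> * real (card W)"
        using \<alpha> by simp
      finally show False
        using inc by simp
    qed
    then have "card W < card V"
      using W fin by (simp add: psubset_card_mono psubsetI)
    moreover have "W \<subseteq> F2n n"
      using W V by blast
    moreover have "\<beta> > 0"
      using \<alpha> \<beta> by simp
    moreover have "real (card B) = \<beta> * real (card W)"
      using cW by (simp add: \<beta>_def)
    ultimately obtain U where U: "f2.subspace U" "U \<subseteq> W"
      and cU: "real (card W) \<le> 2 powr (15 * real d / \<beta>) * real (card U)"
      and miss: "2 ^ d * real (card (U - (B + B))) \<le> real (card U)"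
      using less.hyps[of W B \<beta>] W \<open>B \<subseteq> W\<close> \<open>B \<noteq> {}\<close> by blast
    have "15 * real d / \<beta> \<le> 15 * real d / (5/4 * \<alpha>)"
      using \<beta> \<alpha> by (intro divide_left_mono) auto
    then have exp: "3 * real d / \<alpha> + 15 * real d / \<beta> \<le> 15 * real d / \<alpha>"
      by simp
    have "real (card V) \<le> 2 ^ (m * d) * real (card W)"
      using cVW by (metis of_nat_le_iff of_nat_mult of_nat_numeral of_nat_power)
    also have "(2::real) ^ (m * d) = 2 powr real (m * d)"
      by (rule powr_realpow[symmetric]) simp
    also have "\<dots> \<le> 2 powr (3 * real d / \<alpha>)"
      using mult_right_mono[OF m(2), of "real d"] by (intro powr_mono) auto
    finally have "real (card V) \<le> 2 powr (3 * real d / \<alpha>) * real (card W)"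
      by (simp add: mult_right_mono)
    also have "\<dots> \<le> 2 powr (3 * real d / \<alpha>) * (2 powr (15 * real d / \<beta>) * real (card U))"
      using cU by (intro mult_left_mono) auto
    also have "\<dots> = 2 powr (3 * real d / \<alpha> + 15 * real d / \<beta>) * real (card U)"
      by (simp add: powr_add)
    also have "\<dots> \<le> 2 powr (15 * real d / \<alpha>) * real (card U)"
      using exp by (intro mult_right_mono powr_mono) auto
    finally have "real (card V) \<le> 2 powr (15 * real d / \<alpha>) * real (card U)" .
    moreover have "card (U - (A + A)) \<le> card (U - (B + B))"
      using BA finW U by (intro card_mono) (auto intro: finite_subset)
    then have "2 ^ d * real (card (U - (A + A))) \<le> 2 ^ d * real (card (U - (B + B)))"
      by simp
    with miss have "2 ^ d * real (card (U - (A + A))) \<le> real (card U)"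
      by linarith
    ultimately show ?thesis
      using U W zero by (intro exI[of _ U]) auto
  qed
qed

section \<open>Greedy construction of a subspace inside a nearly full set\<close>

text \<open>The only scalars are 0 and 1, and subtraction agrees with addition, so a new vector adds
  a single translate of the old span.\<close>

lemma f2_span_insert: "f2.span (insert b B) = f2.span B \<union> (+) b ` f2.span B"
proof -
  have "f2.span (insert b B) = {x. \<exists>k. x + f2_scale k b \<in> f2.span B}"
    by (auto simp: f2.span_insert fun_diff_def plus_fun_def fun_eq_iff)
  also have "\<dots> = f2.span B \<union> (+) b ` f2.span B"
  proof (intro set_eqI iffI)
    fix x assume "x \<in> {x. \<exists>k. x + f2_scale k b \<in> f2.span B}"
    then obtain k where k: "x + f2_scale k b \<in> f2.span B"
      by blast
    show "x \<in> f2.span B \<union> (+) b ` f2.span B"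
    proof (cases k)
      case zero
      with k show ?thesis by simp
    next
      case one
      with k have "b + x \<in> f2.span B"
        by (simp add: add.commute)
      then have "b + (b + x) \<in> (+) b ` f2.span B"
        by blast
      then show ?thesis by simp
    qed
  next
    fix x assume "x \<in> f2.span B \<union> (+) b ` f2.span B"
    then have "x \<in> f2.span B \<or> b + x \<in> f2.span B"
      by (auto simp only: Un_iff image_iff bit_fun_add_left_cancel)
    then have "x + f2_scale 0 b \<in> f2.span B \<or> x + f2_scale 1 b \<in> f2.span B"
      by (simp add: add.commute)
    then show "x \<in> {x. \<exists>k. x + f2_scale k b \<in> f2.span B}"
      by blast
  qed
  finally show ?thesis .
qed

text \<open>Basis vectors are added one at a time; as long as fewer than \<open>d\<close> have been
  chosen, the forbidden choices do not exhaust \<open>W\<close>.\<close>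

lemma ex_subspace_greedy:
  assumes W: "f2.subspace W" "finite W" and S: "0 \<in> S"
    and miss: "2 ^ d * card (W - S) \<le> card W" and large: "2 ^ d < card W"
  shows "\<exists>U. f2.subspace U \<and> U \<subseteq> S \<and> f2.dim U = d"
proof -
  have "\<exists>B. finite B \<and> f2.independent B \<and> card B = i \<and> f2.span B \<subseteq> W \<inter> S \<and>
      card (f2.span B) \<le> 2 ^ i" if "i \<le> d" for i
    using that
  proof (induction i)
    case 0
    show ?case
      using W S f2.subspace_0 by (intro exI[of _ "{}"]) (auto simp: f2.independent_empty)
  next
    case (Suc i)
    then obtain B where B: "finite B" "f2.independent B" "card B = i" "f2.span B \<subseteq> W \<inter> S"
      and cB: "card (f2.span B) \<le> 2 ^ i"
      by auto
    have finB: "finite (f2.span B)"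
      using B W by (meson finite_subset le_infE)
    \<comment> \<open>The first part breaks independence; the second consists of the
      \<open>b\<close> for which some \<open>b + u\<close> with \<open>u\<close> in the old span
      falls into \<open>W - S\<close>.\<close>
    define bad where "bad = f2.span B \<union> (\<Union>u\<in>f2.span B. (+) u ` (W - S))"
    have "card (\<Union>u\<in>f2.span B. (+) u ` (W - S)) \<le> (\<Sum>u\<in>f2.span B. card ((+) u ` (W - S)))"
      by (rule card_UN_le[OF finB])
    also have "\<dots> \<le> (\<Sum>u\<in>f2.span B. card (W - S))"
      using W by (intro sum_mono card_image_le) auto
    also have "\<dots> \<le> 2 ^ i * card (W - S)"
      using cB by simp
    finally have "card bad \<le> 2 ^ i + 2 ^ i * card (W - S)"
      unfolding bad_def using card_Un_le cB by (meson add_mono order_trans)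
    \<comment> \<open>Doubling uses the slack in \<open>Suc i \<le> d\<close>: the terms
      \<open>2 ^ d\<close> and \<open>2 ^ d * card (W - S)\<close> then cost at most
      \<open>card W\<close> each, the first one strictly less.\<close>
    then have "2 * card bad \<le> 2 ^ Suc i + 2 ^ Suc i * card (W - S)"
      by simp
    also have "\<dots> \<le> 2 ^ d + 2 ^ d * card (W - S)"
      using Suc.prems by (intro add_mono mult_right_mono power_increasing) auto
    also have "\<dots> < 2 * card W"
      using miss large by simp
    finally have "card bad < card W"
      by simp
    moreover have "finite bad"
      using finB W by (auto simp: bad_def)
    ultimately obtain b where b: "b \<in> W" "b \<notin> bad"
      by (meson card_mono not_less subsetI)
    have "b + u \<in> W \<inter> S" if u: "u \<in> f2.span B" for u
    proof -
      have "b + u \<in> W"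
        using u b B W f2.subspace_add by blast
      moreover have "b + u \<in> S"
      proof (rule ccontr)
        assume "b + u \<notin> S"
        with \<open>b + u \<in> W\<close> have "u + (b + u) \<in> (+) u ` (W - S)"
          by blast
        moreover have "u + (b + u) = b"
          by (metis add.commute bit_fun_add_left_cancel)
        ultimately show False
          using b u by (auto simp: bad_def)
      qed
      ultimately show ?thesis by blast
    qed
    then have "f2.span (insert b B) \<subseteq> W \<inter> S"
      using B by (auto simp: f2_span_insert)
    moreover have "card (f2.span (insert b B)) \<le> 2 ^ Suc i"
      unfolding f2_span_insert
      using card_Un_le[of "f2.span B" "(+) b ` f2.span B"] card_image_le[OF finB, of "(+) b"] cB
      by simp
    moreover have "b \<notin> f2.span B"
      using b by (auto simp: bad_def)
    then have "f2.independent (insert b B)" "b \<notin> B"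
      using B(2) f2.span_base by (auto simp: f2.independent_insert)
    ultimately show ?case
      using B by (intro exI[of _ "insert b B"]) auto
  qed
  from this[of d] obtain B where "finite B" "f2.independent B" "card B = d" "f2.span B \<subseteq> S"
    by auto
  then show ?thesis
    using f2.dim_eq_card[of B "f2.span B"] f2.subspace_span[of B] by (metis f2.span_span)
qed

section \<open>Assembling the bounds\<close>

lemma ex_subspace_of_dim:
  assumes A: "A \<subseteq> F2n n" "A \<noteq> {}" and d: "16 * real d < rel_density n A * real n"
  shows "\<exists>U. f2.subspace U \<and> U \<subseteq> A + A \<and> f2.dim U = d"
proof -
  define \<alpha> where "\<alpha> = rel_density n A"
  have "finite A"
    using A finite_F2n finite_subset by blast
  then have \<alpha>: "\<alpha> > 0"
    using A by (simp add: \<alpha>_def rel_density_def card_F2n card_gt_0_iff)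
  have "card A \<le> card (F2n n)"
    using A finite_F2n by (intro card_mono)
  then have \<alpha>1: "\<alpha> \<le> 1"
    by (simp add: \<alpha>_def rel_density_def card_F2n)
  have dens: "real (card A) = \<alpha> * real (card (F2n n))"
    by (simp add: \<alpha>_def rel_density_def card_F2n)
  obtain W where W: "f2.subspace W" "W \<subseteq> F2n n"
    and cW: "real (card (F2n n)) \<le> 2 powr (15 * real d / \<alpha>) * real (card W)"
    and miss: "2 ^ d * real (card (W - (A + A))) \<le> real (card W)" and zero: "0 \<in> A + A"
    using ex_subspace_almost_covered[OF subspace_F2n subset_refl A \<alpha> dens] by blast
  \<comment> \<open>The codimension of \<open>W\<close> uses \<open>15 * d / \<alpha>\<close>, and
    the greedy construction needs \<open>d\<close> more dimensions;
    \<open>d \<le> d / \<alpha>\<close> bounds the total by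
    \<open>16 * d / \<alpha>\<close>.\<close>
  have "real d * \<alpha> \<le> real d * 1"
    using \<alpha>1 by (intro mult_left_mono) auto
  then have "15 * real d / \<alpha> + d < n"
    using d \<alpha> by (simp add: \<alpha>_def[symmetric] field_simps)
  then have "2 powr (15 * real d / \<alpha>) * 2 powr d < 2 powr n"
    by (simp add: powr_add[symmetric])
  also have "\<dots> = real (card (F2n n))"
    by (simp add: card_F2n powr_realpow)
  also note cW
  finally have "(2::real) ^ d < real (card W)"
    by (simp add: powr_realpow)
  then have "2 ^ d < card W"
    by (metis of_nat_less_iff of_nat_numeral of_nat_power)
  moreover have "2 ^ d * card (W - (A + A)) \<le> card W"
    using miss by (metis of_nat_le_iff of_nat_mult of_nat_numeral of_nat_power)
  moreover have "finite W"
    using W finite_F2n finite_subset by blast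
  ultimately show ?thesis
    using ex_subspace_greedy[OF W(1) _ zero] by blast
qed

text \<open>Two distinct elements give the line spanned by \<open>a + b\<close>. This covers the
  range in which the dimension asked for is below 1.\<close>

lemma ex_subspace_dim_1:
  assumes "finite A" "A \<noteq> {}" "card A \<noteq> 1"
  shows "\<exists>V. f2.subspace V \<and> V \<subseteq> A + A \<and> f2.dim V = 1"
proof -
  obtain a b where ab: "a \<in> A" "b \<in> A" "a \<noteq> b"
    using assms card_le_Suc0_iff_eq[of A] by (force simp: le_Suc_eq)
  have "a + b \<noteq> 0"
    using ab by (simp add: bit_fun_add_eq_0_iff)
  then have ind: "f2.independent {a + b}"
    by simp
  have "f2.span {a + b} = {0, a + b}"
    using f2_span_insert[of "a + b" "{}"] by auto
  moreover have "0 \<in> A + A"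
    using set_plus_intro[OF ab(1) ab(1)] by simp
  ultimately have "f2.span {a + b} \<subseteq> A + A"
    using ab by auto
  then show ?thesis
    using f2.dim_eq_card_independent[OF ind] f2.dim_span[of "{a + b}"] f2.subspace_span
    by (intro exI[of _ "f2.span {a + b}"]) auto
qed

theorem theorem1p5:
  "\<exists>c::real. c > 0 \<and>
     (\<forall>(n::nat) (A::(nat \<Rightarrow> bit) set).
        n \<ge> 1 \<and> A \<subseteq> F2n n \<and> rel_density n A > 0 \<longrightarrow>
        (\<exists>V. f2.subspace V \<and> V \<subseteq> A + A \<and>
             int (f2.dim V) \<ge> \<lfloor>c * rel_density n A * real n\<rfloor> \<and>
             (card A \<noteq> 1 \<longrightarrow> real (f2.dim V) \<ge> c * rel_density n A * real n)))"
proof (intro exI[of _ "1/32"] conjI allI impI)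
  fix n :: nat and A :: "(nat \<Rightarrow> bit) set"
  assume asm: "n \<ge> 1 \<and> A \<subseteq> F2n n \<and> rel_density n A > 0"
  define t where "t = rel_density n A * real n"
  have A: "A \<subseteq> F2n n" "A \<noteq> {}"
    using asm by (auto simp: rel_density_def)
  have finA: "finite A"
    using A finite_F2n finite_subset by blast
  have "t > 0"
    using asm by (simp add: t_def)
  have "\<exists>V. f2.subspace V \<and> V \<subseteq> A + A \<and> int (f2.dim V) \<ge> \<lfloor>t / 32\<rfloor> \<and>
      (card A \<noteq> 1 \<longrightarrow> real (f2.dim V) \<ge> t / 32)"
  \<comment> \<open>Here \<open>t / 32\<close> is below 1 and its floor is at most 0: the zero
    subspace serves a singleton, a line serves every other set.\<close>
  proof (cases "t < 32")
    case True
    then have floor: "\<lfloor>t / 32\<rfloor> \<le> 0"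
      by linarith
    show ?thesis
    proof (cases "card A = 1")
      case True
      obtain a where "a \<in> A"
        using A by blast
      then have "{0} \<subseteq> A + A"
        using set_plus_intro[of a A a A] by simp
      then show ?thesis
        using True floor f2.subspace_single_0
        by (intro exI[of _ "{0}"]) (auto intro: order_trans[of _ 0])
    next
      case False
      then show ?thesis
        using ex_subspace_dim_1[OF finA A(2)] floor \<open>t < 32\<close> by fastforce
    qed
  next
    case False
    \<comment> \<open>The largest integer with \<open>16 * d < t\<close>, the strict bound required
      above. For \<open>t \<ge> 32\<close> it is at least \<open>t / 16 - 1 \<ge> t / 32\<close>,
      which is where the constant \<open>1/32\<close> comes from.\<close>
    define d where "d = nat (\<lceil>t / 16\<rceil> - 1)"
    have "16 * real d < t" "t / 32 \<le> real d"
      using False unfolding d_def by linarith+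
    moreover from this obtain V where "f2.subspace V" "V \<subseteq> A + A" "f2.dim V = d"
      using ex_subspace_of_dim[OF A, of d] by (auto simp: t_def)
    moreover have "\<lfloor>t / 32\<rfloor> \<le> int d"
      using \<open>t / 32 \<le> real d\<close> by linarith
    ultimately show ?thesis
      by blast
  qed
  then show "\<exists>V. f2.subspace V \<and> V \<subseteq> A + A \<and>
      int (f2.dim V) \<ge> \<lfloor>1/32 * rel_density n A * real n\<rfloor> \<and>
      (card A \<noteq> 1 \<longrightarrow> real (f2.dim V) \<ge> 1/32 * rel_density n A * real n)"
    by (simp add: t_def)
qed simp

end
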